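(* Let $(Q,I)$ be a locally gentle bound quiver with associated algebra $A=KQ/I$ satisfying $\mathfrak M_A\sqcup\mathfrak T_A\neq\emptyset$, let $\deg:Q_1\to\mathbb Z$ be a function and $k$ a positive integer. Extend $\deg$ to $\deg:Q_1^{(k)}\to\mathbb Z$ by $\deg(\alpha^{[i]})=\deg(\alpha)$ for $\alpha\in Q_1$, $1\le i\le k$, and $\deg(\varpi_p^{[i]})=w_p$ for $1\le p\le d$, $1\le i\le k-1$, where $w_1,\dots,w_d\in\mathbb Z$ are arbitrarily chosen. Then for any $l\in\mathbb N$, $$\phi_{A^{(k)},\deg}(0,l)=k\,\phi_{A,\deg}(0,l).$$
   Context: $K$ is an algebraically closed field; $\mathbb N=\{0,1,2,\dots\}$. A quiver $Q=(Q_0,Q_1,s,t)$ is finite. Paths are composed from left to right: $\alpha_1\cdots\alpha_l$ (arrows $\alpha_i$, $l\ge1$) is a path of length $l$ if $t(\alpha_i)=s(\alpha_{i+1})$. A bound quiver $(Q,I)$ is locally gentle if $I$ is an ideal of $KQ$ generated by a set of paths of length $2$, every vertex $a$ has in-degree $d_{\rm in}(a)\le 2$ and out-degree $d_{\rm out}(a)\le 2$, and for every arrow $\alpha$ there is at most one arrow $\beta$ with $t(\beta)=s(\alpha)$, $\beta\alpha\in I$; at most one with $t(\beta)=s(\alpha)$, $\beta\alpha\notin I$; at most one with $s(\beta)=t(\alpha)$, $\alpha\beta\in I$; at most one with $s(\beta)=t(\alpha)$, $\alpha\beta\notin I$. Standing assumptions: $Q$ is connected and $Q_1\neq\emptyset$.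 A path in $A=KQ/I$ is a path of $Q$ not in $I$. $\mathfrak M_A$ is the set of maximal paths: paths $\rho$ of positive length in $A$ such that neither $\alpha\rho$ nor $\rho\alpha$ is a path in $A$ for any arrow $\alpha$. $\mathfrak T_A\subseteq Q_0$ is the set of vertices $a$ with $d_{\rm in}(a)\le1$, $d_{\rm out}(a)\le1$ and $\beta\gamma\notin I$ for all arrows $\beta,\gamma$ with $t(\beta)=s(\gamma)=a$. An oriented cycle (resp. anticycle) in $A$ is a sequence $\alpha_1\cdots\alpha_m$ of pairwise distinct arrows, $m\ge1$, with $t(\alpha_i)=s(\alpha_{i+1})$ and $\alpha_i\alpha_{i+1}\notin I$ (resp. $\in I$) for all $i$ modulo $m$; cyclic rotations are identified when counting. Blossoming: $(Q^{\rm bl},I^{\rm bl})$ is obtained by adding, for each $v\in Q_0$, $2-d_{\rm in}(v)$ incoming arrows from new pairwise distinct vertices and $2-d_{\rm out}(v)$ outgoing arrows to new pairwise distinct vertices, and adding length-two relations so that the result is locally gentle and $\alpha\beta\in I\Leftrightarrow\alpha\beta\in I^{\rm bl}$ for $\alpha,\beta\in Q_1$ (unique up to isomorphism). Put $d=2|Q_0|-|Q_1|$ (positive iff $\mathfrak M_A\sqcup\mathfrak T_A\ne\emptyset$). The new vertices are $d$ sources $s_1,\dots,s_d$ and $d$ sinks $t_1,\dots,t_d$; $\sigma_p$ is the unique arrow starting at $s_p$, $\tau_p$ the unique arrow ending at $t_p$; the labeling is chosen so that for each $p$ there is a maximal path from $s_p$ to $t_p$ in $KQ^{\rm bl}/I^{\rm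 bl}$. Finite gentle repetition: $A^{(k)}=KQ^{(k)}/I^{(k)}$, where $Q^{(k)}$ has vertices $a^{[i]}$ ($a\in Q_0$, $1\le i\le k$), arrows $\alpha^{[i]}:s(\alpha)^{[i]}\to t(\alpha)^{[i]}$ ($\alpha\in Q_1$, $1\le i\le k$), and $\varpi_p^{[i]}: s(\tau_p)^{[i]}\to t(\sigma_p)^{[i+1]}$ ($1\le p\le d$, $1\le i<k$); $I^{(k)}$ is generated by the $\alpha^{[i]}\beta^{[i]}$ with $\alpha\beta\in I$, the $\alpha^{[i]}\varpi_p^{[i]}$ with $\alpha\tau_p\in I^{\rm bl}$, the $\varpi_p^{[i]}\beta^{[i+1]}$ with $\sigma_p\beta\in I^{\rm bl}$, and the $\varpi_p^{[i]}\varpi_{p'}^{[i+1]}$ with $\sigma_p\tau_{p'}\in I^{\rm bl}$ (composable arrows, $\alpha,\beta\in Q_1$). It is locally gentle. Graded invariants at $q=0$: for an oriented cycle $\rho=\alpha_1\cdots\alpha_m$ put $\deg(\rho)=\sum_i\deg(\alpha_i)$; for an anticycle $\omega=\alpha_1\cdots\alpha_m$ put $\overline{\deg}(\omega)=m-\sum_i\deg(\alpha_i)$. Then $\phi_{A,\deg}(0,l)$ is the number of oriented cycles $\rho$ in $A$ with $\deg(\rho)=l$ plus the number of anticycles $\omega$ in $A$ with $\overline{\deg}(\omega)=l$; similarly for $A^{(k)}$. *)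

theory Defs
  imports
    "Graph_Theory.Digraph_Component"
    "HOL-Algebra.Ideal"
    "HOL-Library.Poly_Mapping"
    "HOL-Computational_Algebra.Polynomial"
begin

section \<open>Path algebras\<close>

text \<open>
  A finite quiver is a \<^locale>\<open>fin_digraph\<close>; loops and parallel arrows are allowed.
  A path is a pair of its starting vertex and its list of arrows, so that \<open>(v, [])\<close> is the
  stationary path at \<open>v\<close>.
\<close>

type_synonym ('v, 'e) qpath = "'v \<times> 'e list"

definition qpaths :: "('v, 'e) pre_digraph \<Rightarrow> ('v, 'e) qpath set" where
  "qpaths Q = {(u, as). \<exists>v. pre_digraph.awalk Q u as v}"

definition path_target :: "('v, 'e) pre_digraph \<Rightarrow> ('v, 'e) qpath \<Rightarrow> 'v" where
  "path_target Q p = last (pre_digraph.awalk_verts Q (fst p) (snd p))"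

text \<open>
  Elements of \<open>KQ\<close> are the finitely supported functions from paths to \<open>K\<close>.
\<close>

definition path_mult ::
  "('v, 'e) pre_digraph \<Rightarrow> (('v, 'e) qpath \<Rightarrow>\<^sub>0 'k) \<Rightarrow> (('v, 'e) qpath \<Rightarrow>\<^sub>0 'k) \<Rightarrow> (('v, 'e) qpath \<Rightarrow>\<^sub>0 'k::field)"
where
  "path_mult Q f g = (\<Sum>p\<in>Poly_Mapping.keys f. \<Sum>q\<in>Poly_Mapping.keys g.
     if path_target Q p = fst q
     then Poly_Mapping.single (fst p, snd p @ snd q) (Poly_Mapping.lookup f p * Poly_Mapping.lookup g q) else 0)"

definition path_algebra :: "('v, 'e) pre_digraph \<Rightarrow> (('v, 'e) qpath \<Rightarrow>\<^sub>0 'k::field) ring" where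
  "path_algebra Q =
    \<lparr> carrier = {f. Poly_Mapping.keys f \<subseteq> qpaths Q},
      monoid.mult = path_mult Q,
      one = (\<Sum>v\<in>verts Q. Poly_Mapping.single (v, []) 1),
      zero = 0,
      add = (+) \<rparr>"

definition path_elem :: "('v, 'e) qpath \<Rightarrow> (('v, 'e) qpath \<Rightarrow>\<^sub>0 'k::field)" where
  "path_elem p = Poly_Mapping.single p 1"

text \<open>
  The library's \<^const>\<open>genideal\<close> is only meaningful over a \<^locale>\<open>ring\<close>, so we show that
  the path algebra of a finite quiver is one.
\<close>

lemma path_mult_superset:
  fixes f g :: "('v, 'e) qpath \<Rightarrow>\<^sub>0 'k::field"
  assumes "finite A" "finite B" "Poly_Mapping.keys f \<subseteq> A" "Poly_Mapping.keys g \<subseteq> B"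
  shows "path_mult Q f g = (\<Sum>p\<in>A. \<Sum>q\<in>B.
     if path_target Q p = fst q
     then Poly_Mapping.single (fst p, snd p @ snd q) (Poly_Mapping.lookup f p * Poly_Mapping.lookup g q) else 0)"
proof -
  have inner: "(\<Sum>q\<in>Poly_Mapping.keys g. if path_target Q p = fst q
       then Poly_Mapping.single (fst p, snd p @ snd q) (Poly_Mapping.lookup f p * Poly_Mapping.lookup g q) else 0)
     = (\<Sum>q\<in>B. if path_target Q p = fst q
       then Poly_Mapping.single (fst p, snd p @ snd q) (Poly_Mapping.lookup f p * Poly_Mapping.lookup g q) else 0)" for p
    using assms by (intro sum.mono_neutral_left) (auto simp: in_keys_iff)
  show ?thesis
    unfolding path_mult_def inner
    using assms by (intro sum.mono_neutral_left) (auto simp: in_keys_iff intro!: sum.neutral)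
qed

lemma path_mult_add_left:
  "path_mult Q (f + f') g = path_mult Q f g + path_mult Q f' g"
proof -
  let ?A = "Poly_Mapping.keys f \<union> Poly_Mapping.keys f'"
  let ?B = "Poly_Mapping.keys g"
  have k: "Poly_Mapping.keys (f + f') \<subseteq> ?A" by (rule Poly_Mapping.keys_add)
  have fin: "finite ?A" "finite ?B" by auto
  show ?thesis
    unfolding path_mult_superset[OF fin k order_refl]
      path_mult_superset[OF fin Un_upper1 order_refl]
      path_mult_superset[OF fin Un_upper2 order_refl]
      sum.distrib[symmetric]
    by (intro sum.cong refl) (auto simp: lookup_add distrib_right single_add)
qed

lemma path_mult_add_right:
  "path_mult Q f (g + g') = path_mult Q f g + path_mult Q f g'"
proof -
  let ?A = "Poly_Mapping.keys f"
  let ?B = "Poly_Mapping.keys g \<union> Poly_Mapping.keys g'"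
  have k: "Poly_Mapping.keys (g + g') \<subseteq> ?B" by (rule Poly_Mapping.keys_add)
  have fin: "finite ?A" "finite ?B" by auto
  show ?thesis
    unfolding path_mult_superset[OF fin order_refl k]
      path_mult_superset[OF fin order_refl Un_upper1]
      path_mult_superset[OF fin order_refl Un_upper2]
      sum.distrib[symmetric]
    by (intro sum.cong refl) (auto simp: lookup_add distrib_left single_add)
qed

lemma path_mult_zero [simp]: "path_mult Q 0 g = 0" "path_mult Q f 0 = 0"
  by (simp_all add: path_mult_def)

lemma path_mult_single:
  "path_mult Q (Poly_Mapping.single p a) (Poly_Mapping.single q b) =
    (if path_target Q p = fst q then Poly_Mapping.single (fst p, snd p @ snd q) (a * b) else 0)"
  by (simp add: path_mult_superset[where A = "{p}" and B = "{q}"])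

lemma path_target_append:
  "path_target Q p = fst q \<Longrightarrow> path_target Q (fst p, snd p @ snd q) = path_target Q q"
  by (auto simp: path_target_def pre_digraph.awalk_verts_conv)

lemma poly_mapping_sum_singles:
  "(\<Sum>p\<in>Poly_Mapping.keys x. Poly_Mapping.single p (Poly_Mapping.lookup x p)) = x"
  by (rule poly_mapping_eqI) (auto simp: lookup_sum lookup_single when_def in_keys_iff)

lemma poly_mapping_single_induct [case_names single sum]:
  fixes f :: "'a \<Rightarrow>\<^sub>0 'b::comm_monoid_add"
  assumes single: "\<And>p a. P (Poly_Mapping.single p a)"
    and sum: "\<And>f g. P f \<Longrightarrow> P g \<Longrightarrow> P (f + g)"
  shows "P f"
proof -
  have "P (\<Sum>p\<in>A. Poly_Mapping.single p (Poly_Mapping.lookup f p))" if "finite A" for A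
    using that
  proof (induction A rule: finite_induct)
    case empty
    show ?case using single[of undefined 0] by simp
  next
    case (insert p A)
    then show ?case by (simp add: single sum)
  qed
  from this[OF finite_keys, of f] show ?thesis by (simp only: poly_mapping_sum_singles)
qed

lemma path_mult_assoc:
  "path_mult Q (path_mult Q f g) h = path_mult Q f (path_mult Q g h)"
proof (induction f rule: poly_mapping_single_induct)
  case (single p a)
  show ?case
  proof (induction g rule: poly_mapping_single_induct)
    case (single q b)
    show ?case
    proof (induction h rule: poly_mapping_single_induct)
      case (single r c)
      show ?case
        by (simp add: path_mult_single path_target_append mult.assoc)
    qed (simp add: path_mult_add_right)
  qed (simp add: path_mult_add_left path_mult_add_right)
qed (simp add: path_mult_add_left)

lemma path_mult_closed:
  assumes f: "Poly_Mapping.keys f \<subseteq> qpaths Q" and g: "Poly_Mapping.keys g \<subseteq> qpaths Q"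
  shows "Poly_Mapping.keys (path_mult Q f g) \<subseteq> qpaths Q"
proof -
  have cas: "pre_digraph.cas Q u (as @ bs) w"
    if "pre_digraph.cas Q u as v" "pre_digraph.cas Q v bs w" for u v w as bs
    using that by (induction as arbitrary: u) (auto simp: pre_digraph.cas.simps)
  have last: "last (pre_digraph.awalk_verts Q u as) = v" if "pre_digraph.cas Q u as v" for u v as
    using that
    by (induction as arbitrary: u)
      (auto simp: pre_digraph.cas.simps pre_digraph.awalk_verts.simps
        pre_digraph.awalk_verts_non_Nil)
  have *: "(fst p, snd p @ snd q) \<in> qpaths Q"
    if pq: "p \<in> qpaths Q" "q \<in> qpaths Q" and tgt: "path_target Q p = fst q" for p q
  proof -
    obtain v w where "pre_digraph.awalk Q (fst p) (snd p) v" "pre_digraph.awalk Q (fst q) (snd q) w"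
      using pq by (auto simp: qpaths_def)
    moreover from this have "v = fst q"
      using last tgt unfolding pre_digraph.awalk_def path_target_def by blast
    ultimately have "pre_digraph.awalk Q (fst p) (snd p @ snd q) w"
      using cas unfolding pre_digraph.awalk_def by auto
    then show ?thesis by (auto simp: qpaths_def)
  qed
  have "Poly_Mapping.keys (path_mult Q f g) \<subseteq> (\<Union>p\<in>Poly_Mapping.keys f. \<Union>q\<in>Poly_Mapping.keys g. Poly_Mapping.keys
     (if path_target Q p = fst q
     then Poly_Mapping.single (fst p, snd p @ snd q) (Poly_Mapping.lookup f p * Poly_Mapping.lookup g q) else 0))"
    unfolding path_mult_def
    by (intro order_trans[OF Poly_Mapping.keys_sum] UN_mono order_refl)
  also have "\<dots> \<subseteq> qpaths Q"
  proof (intro UN_least)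
    fix p q assume "p \<in> Poly_Mapping.keys f" "q \<in> Poly_Mapping.keys g"
    then have "p \<in> qpaths Q" "q \<in> qpaths Q" using f g by auto
    then show "Poly_Mapping.keys (if path_target Q p = fst q
        then Poly_Mapping.single (fst p, snd p @ snd q) (Poly_Mapping.lookup f p * Poly_Mapping.lookup g q) else 0)
        \<subseteq> qpaths Q"
      using *[of p q] by auto
  qed
  finally show ?thesis .
qed

lemma (in fin_digraph) ring_path_algebra: "ring (path_algebra G :: (_ \<Rightarrow>\<^sub>0 'k::field) ring)"
proof (rule ringI)
  let ?R = "path_algebra G :: (_ \<Rightarrow>\<^sub>0 'k) ring"
  let ?E = "(\<lambda>v. (v, [])) ` verts G :: ('a, 'b) qpath set"
  have one: "one ?R = (\<Sum>p\<in>?E. Poly_Mapping.single p 1)"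
    by (simp add: path_algebra_def sum.reindex inj_on_def)
  have lookup_one: "Poly_Mapping.lookup (one ?R) p = (if p \<in> ?E then 1 else 0)" for p
    by (simp add: one lookup_sum lookup_single when_def)
  have keys_one: "Poly_Mapping.keys (one ?R) \<subseteq> ?E"
    by (auto simp: in_keys_iff lookup_one split: if_splits)
  show "abelian_group ?R"
  proof (rule abelian_groupI)
    fix x assume "x \<in> carrier ?R"
    then show "\<exists>y\<in>carrier ?R. y \<oplus>\<^bsub>?R\<^esub> x = \<zero>\<^bsub>?R\<^esub>"
      by (intro bexI[of _ "- x"]) (auto simp: path_algebra_def)
  next
    fix x y assume "x \<in> carrier ?R" "y \<in> carrier ?R"
    then show "x \<oplus>\<^bsub>?R\<^esub> y \<in> carrier ?R"
      using Poly_Mapping.keys_add[of x y] by (auto simp: path_algebra_def)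
  qed (auto simp: path_algebra_def algebra_simps)
  show "monoid ?R"
  proof (rule monoidI)
    show "\<one>\<^bsub>?R\<^esub> \<in> carrier ?R"
      using keys_one by (force simp: path_algebra_def qpaths_def awalk_Nil_iff)
  next
    fix x assume "x \<in> carrier ?R"
    then have x: "Poly_Mapping.keys x \<subseteq> qpaths G" by (simp add: path_algebra_def)
    have src: "fst p \<in> verts G" and tgt: "path_target G p \<in> verts G" if "p \<in> Poly_Mapping.keys x" for p
      using that x
      by (force simp: qpaths_def path_target_def intro: awalk_hd_in_verts,
          force simp: qpaths_def path_target_def dest: awalk_last_in_verts elim: awalkE)
    have "path_mult G (one ?R) x = (\<Sum>e\<in>?E. \<Sum>p\<in>Poly_Mapping.keys x.
        if e = (fst p, []) then Poly_Mapping.single p (Poly_Mapping.lookup x p) else 0)"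
      unfolding path_mult_superset[OF finite_imageI[OF finite_verts] finite_keys keys_one order_refl]
      by (intro sum.cong refl) (auto simp: lookup_one path_target_def awalk_verts.simps)
    also have "\<dots> = x"
      using src by (subst sum.swap) (simp add: poly_mapping_sum_singles)
    finally show "\<one>\<^bsub>?R\<^esub> \<otimes>\<^bsub>?R\<^esub> x = x" by (simp add: path_algebra_def)
    have "path_mult G x (one ?R) = (\<Sum>p\<in>Poly_Mapping.keys x. \<Sum>e\<in>?E.
        if e = (path_target G p, []) then Poly_Mapping.single p (Poly_Mapping.lookup x p) else 0)"
      unfolding path_mult_superset[OF finite_keys finite_imageI[OF finite_verts] order_refl keys_one]
      by (intro sum.cong refl) (auto simp: lookup_one)
    also have "\<dots> = x"
      using tgt by (simp add: poly_mapping_sum_singles)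
    finally show "x \<otimes>\<^bsub>?R\<^esub> \<one>\<^bsub>?R\<^esub> = x" by (simp add: path_algebra_def)
  next
    fix x y assume "x \<in> carrier ?R" "y \<in> carrier ?R"
    then show "x \<otimes>\<^bsub>?R\<^esub> y \<in> carrier ?R"
      using path_mult_closed[of x G y] by (simp add: path_algebra_def)
  qed (simp add: path_algebra_def path_mult_assoc)
qed (simp_all add: path_algebra_def path_mult_add_left path_mult_add_right)


section \<open>Locally gentle bound quivers\<close>

definition path2 :: "('v, 'e) pre_digraph \<Rightarrow> 'e \<Rightarrow> 'e \<Rightarrow> ('v, 'e) qpath" where
  "path2 Q \<alpha> \<beta> = (tail Q \<alpha>, [\<alpha>, \<beta>])"

definition composable :: "('v, 'e) pre_digraph \<Rightarrow> 'e \<Rightarrow> 'e \<Rightarrow> bool" where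
  "composable Q \<alpha> \<beta> \<longleftrightarrow> \<alpha> \<in> arcs Q \<and> \<beta> \<in> arcs Q \<and> head Q \<alpha> = tail Q \<beta>"

definition relation ::
  "('v, 'e) pre_digraph \<Rightarrow> (('v, 'e) qpath \<Rightarrow>\<^sub>0 'k::field) set \<Rightarrow> 'e \<Rightarrow> 'e \<Rightarrow> bool" where
  "relation Q I \<alpha> \<beta> \<longleftrightarrow> composable Q \<alpha> \<beta> \<and> path_elem (path2 Q \<alpha> \<beta>) \<in> I"

definition nonrelation ::
  "('v, 'e) pre_digraph \<Rightarrow> (('v, 'e) qpath \<Rightarrow>\<^sub>0 'k::field) set \<Rightarrow> 'e \<Rightarrow> 'e \<Rightarrow> bool" where
  "nonrelation Q I \<alpha> \<beta> \<longleftrightarrow> composable Q \<alpha> \<beta> \<and> path_elem (path2 Q \<alpha> \<beta>) \<notin> I"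

definition locally_gentle ::
  "('v, 'e) pre_digraph \<Rightarrow> (('v, 'e) qpath \<Rightarrow>\<^sub>0 'k::field) set \<Rightarrow> bool" where
  "locally_gentle Q I \<longleftrightarrow>
     fin_digraph Q \<and>
     (\<exists>R \<subseteq> {p \<in> qpaths Q. length (snd p) = 2}. I = Idl\<^bsub>path_algebra Q\<^esub> (path_elem ` R)) \<and>
     (\<forall>a\<in>verts Q. in_degree Q a \<le> 2 \<and> out_degree Q a \<le> 2) \<and>
     (\<forall>\<alpha>\<in>arcs Q.
        (\<exists>\<^sub>\<le>\<^sub>1 \<beta>. relation Q I \<beta> \<alpha>) \<and> (\<exists>\<^sub>\<le>\<^sub>1 \<beta>. nonrelation Q I \<beta> \<alpha>) \<and>
        (\<exists>\<^sub>\<le>\<^sub>1 \<beta>. relation Q I \<alpha> \<beta>) \<and> (\<exists>\<^sub>\<le>\<^sub>1 \<beta>. nonrelation Q I \<alpha> \<beta>))"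

definition nonzero_paths ::
  "('v, 'e) pre_digraph \<Rightarrow> (('v, 'e) qpath \<Rightarrow>\<^sub>0 'k::field) set \<Rightarrow> ('v, 'e) qpath set" where
  "nonzero_paths Q I = {p \<in> qpaths Q. path_elem p \<notin> I}"

definition maximal_paths ::
  "('v, 'e) pre_digraph \<Rightarrow> (('v, 'e) qpath \<Rightarrow>\<^sub>0 'k::field) set \<Rightarrow> ('v, 'e) qpath set" where
  "maximal_paths Q I = {\<rho> \<in> nonzero_paths Q I. length (snd \<rho>) > 0 \<and>
     (\<forall>\<alpha>\<in>arcs Q. \<not> (head Q \<alpha> = fst \<rho> \<and> (tail Q \<alpha>, \<alpha> # snd \<rho>) \<in> nonzero_paths Q I) \<and>
        \<not> (path_target Q \<rho> = tail Q \<alpha> \<and> (fst \<rho>, snd \<rho> @ [\<alpha>]) \<in> nonzero_paths Q I))}"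

definition trivial_maximal_vertices ::
  "('v, 'e) pre_digraph \<Rightarrow> (('v, 'e) qpath \<Rightarrow>\<^sub>0 'k::field) set \<Rightarrow> 'v set" where
  "trivial_maximal_vertices Q I = {a \<in> verts Q. in_degree Q a \<le> 1 \<and> out_degree Q a \<le> 1 \<and>
     (\<forall>\<beta>\<in>arcs Q. \<forall>\<gamma>\<in>arcs Q. head Q \<beta> = a \<and> tail Q \<gamma> = a \<longrightarrow> path_elem (path2 Q \<beta> \<gamma>) \<notin> I)}"

definition oriented_cycle ::
  "('v, 'e) pre_digraph \<Rightarrow> (('v, 'e) qpath \<Rightarrow>\<^sub>0 'k::field) set \<Rightarrow> 'e list \<Rightarrow> bool" where
  "oriented_cycle Q I \<rho> \<longleftrightarrow> \<rho> \<noteq> [] \<and> distinct \<rho> \<and>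
     (\<forall>i<length \<rho>. nonrelation Q I (\<rho> ! i) (\<rho> ! (Suc i mod length \<rho>)))"

definition anticycle ::
  "('v, 'e) pre_digraph \<Rightarrow> (('v, 'e) qpath \<Rightarrow>\<^sub>0 'k::field) set \<Rightarrow> 'e list \<Rightarrow> bool" where
  "anticycle Q I \<omega> \<longleftrightarrow> \<omega> \<noteq> [] \<and> distinct \<omega> \<and>
     (\<forall>i<length \<omega>. relation Q I (\<omega> ! i) (\<omega> ! (Suc i mod length \<omega>)))"

definition rotation_class :: "'e list \<Rightarrow> 'e list set" where
  "rotation_class xs = {rotate n xs | n. True}"

definition cycle_degree :: "('e \<Rightarrow> int) \<Rightarrow> 'e list \<Rightarrow> int" where
  "cycle_degree deg \<rho> = (\<Sum>\<alpha>\<leftarrow>\<rho>. deg \<alpha>)"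

definition anticycle_degree :: "('e \<Rightarrow> int) \<Rightarrow> 'e list \<Rightarrow> int" where
  "anticycle_degree deg \<omega> = int (length \<omega>) - (\<Sum>\<alpha>\<leftarrow>\<omega>. deg \<alpha>)"

text \<open>The values \<open>\<phi>\<^bsub>A,deg\<^esub>(0, l)\<close> of the graded invariant, for \<open>A = KQ/I\<close>.\<close>

definition phi0 ::
  "('v, 'e) pre_digraph \<Rightarrow> (('v, 'e) qpath \<Rightarrow>\<^sub>0 'k::field) set \<Rightarrow> ('e \<Rightarrow> int) \<Rightarrow> nat \<Rightarrow> nat" where
  "phi0 Q I deg l =
     card (rotation_class ` {\<rho>. oriented_cycle Q I \<rho> \<and> cycle_degree deg \<rho> = int l}) +
     card (rotation_class ` {\<omega>. anticycle Q I \<omega> \<and> anticycle_degree deg \<omega> = int l})"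


section \<open>Blossoming\<close>

datatype 'v bl_vertex = Old_vertex (old_vertex: 'v) | New_source 'v nat | New_sink 'v nat

datatype ('v, 'e) bl_arrow = Old_arrow 'e | New_in 'v nat | New_out 'v nat

definition new_sources :: "('v, 'e) pre_digraph \<Rightarrow> 'v bl_vertex set" where
  "new_sources Q = {New_source v j | v j. v \<in> verts Q \<and> j < 2 - in_degree Q v}"

definition new_sinks :: "('v, 'e) pre_digraph \<Rightarrow> 'v bl_vertex set" where
  "new_sinks Q = {New_sink v j | v j. v \<in> verts Q \<and> j < 2 - out_degree Q v}"

definition blossom :: "('v, 'e) pre_digraph \<Rightarrow> ('v bl_vertex, ('v, 'e) bl_arrow) pre_digraph" where
  "blossom Q =
    \<lparr> verts = Old_vertex ` verts Q \<union> new_sources Q \<union> new_sinks Q,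
      arcs = Old_arrow ` arcs Q \<union>
        {New_in v j | v j. v \<in> verts Q \<and> j < 2 - in_degree Q v} \<union>
        {New_out v j | v j. v \<in> verts Q \<and> j < 2 - out_degree Q v},
      tail = (\<lambda>a. case a of Old_arrow \<alpha> \<Rightarrow> Old_vertex (tail Q \<alpha>)
        | New_in v j \<Rightarrow> New_source v j | New_out v j \<Rightarrow> Old_vertex v),
      head = (\<lambda>a. case a of Old_arrow \<alpha> \<Rightarrow> Old_vertex (head Q \<alpha>)
        | New_in v j \<Rightarrow> Old_vertex v | New_out v j \<Rightarrow> New_sink v j) \<rparr>"

text \<open>
  The ideal of the blossoming is only unique up to isomorphism; it is therefore characterised by a
  predicate and not constructed.
\<close>

definition blossom_ideal ::
  "('v, 'e) pre_digraph \<Rightarrow> (('v, 'e) qpath \<Rightarrow>\<^sub>0 'k::field) set \<Rightarrow>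
   (('v bl_vertex, ('v, 'e) bl_arrow) qpath \<Rightarrow>\<^sub>0 'k) set \<Rightarrow> bool" where
  "blossom_ideal Q I Ibl \<longleftrightarrow> locally_gentle (blossom Q) Ibl \<and>
     (\<forall>\<alpha> \<beta>. composable Q \<alpha> \<beta> \<longrightarrow>
        (path_elem (path2 Q \<alpha> \<beta>) \<in> I \<longleftrightarrow>
         path_elem (path2 (blossom Q) (Old_arrow \<alpha>) (Old_arrow \<beta>)) \<in> Ibl))"

text \<open>
  For a locally gentle quiver the subtraction does not truncate, because all in-degrees are at
  most two.
\<close>

definition defect :: "('v, 'e) pre_digraph \<Rightarrow> nat" where
  "defect Q = 2 * card (verts Q) - card (arcs Q)"

definition blossom_labeling ::
  "('v, 'e) pre_digraph \<Rightarrow> (('v bl_vertex, ('v, 'e) bl_arrow) qpath \<Rightarrow>\<^sub>0 'k::field) set \<Rightarrow>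
   (nat \<Rightarrow> 'v bl_vertex) \<Rightarrow> (nat \<Rightarrow> 'v bl_vertex) \<Rightarrow> bool" where
  "blossom_labeling Q Ibl s t \<longleftrightarrow>
     bij_betw s {1..defect Q} (new_sources Q) \<and>
     bij_betw t {1..defect Q} (new_sinks Q) \<and>
     (\<forall>p\<in>{1..defect Q}. \<exists>\<rho>\<in>maximal_paths (blossom Q) Ibl.
        fst \<rho> = s p \<and> path_target (blossom Q) \<rho> = t p)"

definition source_arrow ::
  "('v, 'e) pre_digraph \<Rightarrow> (nat \<Rightarrow> 'v bl_vertex) \<Rightarrow> nat \<Rightarrow> ('v, 'e) bl_arrow" where
  "source_arrow Q s p = (THE a. a \<in> arcs (blossom Q) \<and> tail (blossom Q) a = s p)"

definition sink_arrow ::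
  "('v, 'e) pre_digraph \<Rightarrow> (nat \<Rightarrow> 'v bl_vertex) \<Rightarrow> nat \<Rightarrow> ('v, 'e) bl_arrow" where
  "sink_arrow Q t p = (THE a. a \<in> arcs (blossom Q) \<and> head (blossom Q) a = t p)"


section \<open>Finite gentle repetitions\<close>

text \<open>
  \<open>Copy_arrow \<alpha> i\<close> is the arrow \<open>\<alpha>\<close> in the \<open>i\<close>-th copy, and \<open>Connect p i\<close> is the arrow
  \<open>\<varpi>\<close> with lower index \<open>p\<close> from the \<open>i\<close>-th to the next copy.
\<close>

datatype 'e rep_arrow = Copy_arrow 'e nat | Connect nat nat

definition repetition ::
  "('v, 'e) pre_digraph \<Rightarrow> (nat \<Rightarrow> 'v bl_vertex) \<Rightarrow> (nat \<Rightarrow> 'v bl_vertex) \<Rightarrow> nat \<Rightarrow>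
   ('v \<times> nat, 'e rep_arrow) pre_digraph" where
  "repetition Q s t k =
    \<lparr> verts = verts Q \<times> {1..k},
      arcs = {Copy_arrow \<alpha> i | \<alpha> i. \<alpha> \<in> arcs Q \<and> i \<in> {1..k}} \<union>
        {Connect p i | p i. p \<in> {1..defect Q} \<and> i \<in> {1..<k}},
      tail = (\<lambda>a. case a of Copy_arrow \<alpha> i \<Rightarrow> (tail Q \<alpha>, i)
        | Connect p i \<Rightarrow> (old_vertex (tail (blossom Q) (sink_arrow Q t p)), i)),
      head = (\<lambda>a. case a of Copy_arrow \<alpha> i \<Rightarrow> (head Q \<alpha>, i)
        | Connect p i \<Rightarrow> (old_vertex (head (blossom Q) (source_arrow Q s p)), i + 1)) \<rparr>"

definition repetition_relations ::
  "('v, 'e) pre_digraph \<Rightarrow> (('v, 'e) qpath \<Rightarrow>\<^sub>0 'k::field) set \<Rightarrow>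
   (('v bl_vertex, ('v, 'e) bl_arrow) qpath \<Rightarrow>\<^sub>0 'k) set \<Rightarrow>
   (nat \<Rightarrow> 'v bl_vertex) \<Rightarrow> (nat \<Rightarrow> 'v bl_vertex) \<Rightarrow> nat \<Rightarrow> ('v \<times> nat, 'e rep_arrow) qpath set" where
  "repetition_relations Q I Ibl s t k =
     (let Qk = repetition Q s t k; Qbl = blossom Q; \<sigma> = source_arrow Q s; \<tau> = sink_arrow Q t in
       {path2 Qk (Copy_arrow \<alpha> i) (Copy_arrow \<beta> i) | \<alpha> \<beta> i.
          i \<in> {1..k} \<and> relation Q I \<alpha> \<beta>} \<union>
       {path2 Qk (Copy_arrow \<alpha> i) (Connect p i) | \<alpha> p i.
          p \<in> {1..defect Q} \<and> i \<in> {1..<k} \<and> relation Qbl Ibl (Old_arrow \<alpha>) (\<tau> p)} \<union>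
       {path2 Qk (Connect p i) (Copy_arrow \<beta> (i + 1)) | p \<beta> i.
          p \<in> {1..defect Q} \<and> i \<in> {1..<k} \<and> relation Qbl Ibl (\<sigma> p) (Old_arrow \<beta>)} \<union>
       {path2 Qk (Connect p i) (Connect p' (i + 1)) | p p' i.
          p \<in> {1..defect Q} \<and> p' \<in> {1..defect Q} \<and> i \<in> {1..<k} \<and> i + 1 \<in> {1..<k} \<and>
          relation Qbl Ibl (\<sigma> p) (\<tau> p')})"

definition repetition_ideal ::
  "('v, 'e) pre_digraph \<Rightarrow> (('v, 'e) qpath \<Rightarrow>\<^sub>0 'k::field) set \<Rightarrow>
   (('v bl_vertex, ('v, 'e) bl_arrow) qpath \<Rightarrow>\<^sub>0 'k) set \<Rightarrow>
   (nat \<Rightarrow> 'v bl_vertex) \<Rightarrow> (nat \<Rightarrow> 'v bl_vertex) \<Rightarrow> nat \<Rightarrow>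
   (('v \<times> nat, 'e rep_arrow) qpath \<Rightarrow>\<^sub>0 'k) set" where
  "repetition_ideal Q I Ibl s t k =
     Idl\<^bsub>path_algebra (repetition Q s t k)\<^esub> (path_elem ` repetition_relations Q I Ibl s t k)"

primrec repetition_degree :: "('e \<Rightarrow> int) \<Rightarrow> (nat \<Rightarrow> int) \<Rightarrow> 'e rep_arrow \<Rightarrow> int" where
  "repetition_degree deg w (Copy_arrow \<alpha> i) = deg \<alpha>"
| "repetition_degree deg w (Connect p i) = w p"

end

theory Submission
  imports Defs
begin

text \<open>
  A vertex \<open>(a, i)\<close> of the repetition lies in layer \<open>i\<close>. A copied arrow stays in its layer and a
  connecting arrow leads to the next one, and no arrow leads back. Hence a closed walk never uses a
  connecting arrow and stays in a single layer (\<open>repetition_cyclic_list_in_layer\<close>); in particular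
  the weights of the connecting arrows cannot influence the invariant.

  It remains to see that each layer has exactly the relations of the original quiver. The
  generators of the repetition ideal are paths of length two, and such an ideal contains no paths
  of length two other than its generators, because multiplying a path by a path of positive length
  makes it longer, and multiplying it by a stationary path gives the same path or zero
  (\<open>path_elem_in_genideal_iff\<close>). So the oriented cycles of the repetition are the copies of the
  oriented cycles of the original quiver in each of the \<open>k\<close> layers, with the same degree, and
  likewise for anticycles. Copies in different layers have no arrow in common, so the rotation
  classes are multiplied by \<open>k\<close> (\<open>card_rotation_classes_of_copies\<close>).
\<close>

section \<open>Ideals generated by paths of a fixed length\<close>

lemma carrier_path_algebra: "carrier (path_algebra Q) = {f. Poly_Mapping.keys f \<subseteq> qpaths Q}"
  and mult_path_algebra: "x \<otimes>\<^bsub>path_algebra Q\<^esub> y = path_mult Q x y"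
  and add_path_algebra: "x \<oplus>\<^bsub>path_algebra Q\<^esub> y = x + y"
  and zero_path_algebra: "\<zero>\<^bsub>path_algebra Q\<^esub> = 0"
  by (simp_all add: path_algebra_def)

lemma keys_path_elem [simp]:
  "Poly_Mapping.keys (path_elem p :: _ \<Rightarrow>\<^sub>0 'k::field) = {p}"
  by (simp add: path_elem_def)

lemma keys_path_mult:
  fixes f g :: "('v, 'e) qpath \<Rightarrow>\<^sub>0 'k::field"
  assumes "r \<in> Poly_Mapping.keys (path_mult Q f g)"
  obtains p q where "p \<in> Poly_Mapping.keys f" "q \<in> Poly_Mapping.keys g"
    "path_target Q p = fst q" "r = (fst p, snd p @ snd q)"
proof -
  have "Poly_Mapping.keys (path_mult Q f g)
      \<subseteq> (\<Union>p\<in>Poly_Mapping.keys f. \<Union>q\<in>Poly_Mapping.keys g. Poly_Mapping.keys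
     (if path_target Q p = fst q
     then Poly_Mapping.single (fst p, snd p @ snd q) (Poly_Mapping.lookup f p * Poly_Mapping.lookup g q) else 0))"
    unfolding path_mult_def
    by (intro order_trans[OF Poly_Mapping.keys_sum] UN_mono order_refl)
  with assms that show thesis by (fastforce split: if_splits)
qed

text \<open>
  The witness for the ideal generated by a set \<open>R\<close> of paths of length \<open>n\<close>: everything supported
  on paths longer than \<open>n\<close> or in \<open>R\<close>.
\<close>

lemma (in fin_digraph) ideal_long_or_in:
  fixes R :: "('a, 'b) qpath set" and n :: nat
  defines "T \<equiv> {p \<in> qpaths G. n < length (snd p) \<or> length (snd p) = n \<and> p \<in> R}"
  shows "ideal {f. Poly_Mapping.keys f \<subseteq> T} (path_algebra G :: (_ \<Rightarrow>\<^sub>0 'k::field) ring)"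
proof -
  let ?A = "path_algebra G :: (_ \<Rightarrow>\<^sub>0 'k) ring"
  let ?J = "{f :: _ \<Rightarrow>\<^sub>0 'k. Poly_Mapping.keys f \<subseteq> T}"
  interpret A: ring ?A by (rule ring_path_algebra)
  have T: "T \<subseteq> qpaths G" by (auto simp: T_def)
  have sub: "?J \<subseteq> carrier ?A" using T by (auto simp: carrier_path_algebra)
  have uminus: "\<ominus>\<^bsub>?A\<^esub> f = - f" if "f \<in> carrier ?A" for f
    using that by (intro A.minus_equality)
      (auto simp: carrier_path_algebra add_path_algebra zero_path_algebra)
  show ?thesis
  proof (rule idealI)
    show "ring ?A" by (rule ring_path_algebra)
    show "subgroup ?J (add_monoid ?A)"
    proof (rule group.subgroupI)
      show "group (add_monoid ?A)" by (rule A.a_group)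
      show "?J \<subseteq> carrier (add_monoid ?A)" using sub by simp
      show "?J \<noteq> {}" by (auto intro: exI[of _ 0])
      fix f assume f: "f \<in> ?J"
      have "inv\<^bsub>add_monoid ?A\<^esub> f = - f"
        using uminus[of f] f sub unfolding a_inv_def by blast
      with f show "inv\<^bsub>add_monoid ?A\<^esub> f \<in> ?J" by simp
      fix g assume g: "g \<in> ?J"
      show "f \<otimes>\<^bsub>add_monoid ?A\<^esub> g \<in> ?J"
        using f g Poly_Mapping.keys_add[of f g] by (auto simp: add_path_algebra)
    qed
    fix f x assume f: "f \<in> ?J" and x: "x \<in> carrier ?A"
    have qpaths: "Poly_Mapping.keys f \<subseteq> qpaths G" "Poly_Mapping.keys x \<subseteq> qpaths G"
      using f x T by (auto simp: carrier_path_algebra)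
    note closed = path_mult_closed[OF qpaths(2,1)] path_mult_closed[OF qpaths]
    have "r \<in> T" if r: "r \<in> Poly_Mapping.keys (path_mult G x f)" for r
      using r
    proof (cases rule: keys_path_mult)
      case (1 p q)
      then have "q \<in> T" using f by auto
      moreover have "r \<in> qpaths G" using closed r by auto
      \<comment> \<open>If nothing is gained in length, then \<open>p\<close> is stationary and \<open>r = q\<close>.\<close>
      moreover have "r = q" if "snd p = []"
        using 1 that by (simp add: path_target_def awalk_verts.simps prod_eq_iff)
      ultimately show ?thesis
        using 1 by (cases "snd p = []") (auto simp: T_def)
    qed
    then show "x \<otimes>\<^bsub>?A\<^esub> f \<in> ?J" by (auto simp: mult_path_algebra)
    have "r \<in> T" if r: "r \<in> Poly_Mapping.keys (path_mult G f x)" for r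
      using r
    proof (cases rule: keys_path_mult)
      case (1 p q)
      then have "p \<in> T" using f by auto
      moreover have "r \<in> qpaths G" using closed r by auto
      moreover have "r = p" if "snd q = []" using 1 that by (simp add: prod_eq_iff)
      ultimately show ?thesis
        using 1 by (cases "snd q = []") (auto simp: T_def)
    qed
    then show "f \<otimes>\<^bsub>?A\<^esub> x \<in> ?J" by (auto simp: mult_path_algebra)
  qed
qed

lemma (in fin_digraph) path_elem_in_genideal_iff:
  fixes R :: "('a, 'b) qpath set"
  assumes R: "R \<subseteq> {p \<in> qpaths G. length (snd p) = n}" and p: "length (snd p) = n"
  shows "path_elem p \<in> Idl\<^bsub>path_algebra G\<^esub> (path_elem ` R :: (_ \<Rightarrow>\<^sub>0 'k::field) set) \<longleftrightarrow> p \<in> R"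
proof
  let ?J = "{f :: _ \<Rightarrow>\<^sub>0 'k. Poly_Mapping.keys f
     \<subseteq> {p \<in> qpaths G. n < length (snd p) \<or> length (snd p) = n \<and> p \<in> R}}"
  assume "path_elem p \<in> Idl\<^bsub>path_algebra G\<^esub> (path_elem ` R :: (_ \<Rightarrow>\<^sub>0 'k) set)"
  moreover have "path_elem ` R \<subseteq> ?J" using R by auto
  ultimately have "path_elem p \<in> ?J"
    unfolding genideal_def using ideal_long_or_in[of n R] by blast
  with p show "p \<in> R" by simp
next
  assume "p \<in> R"
  then show "path_elem p \<in> Idl\<^bsub>path_algebra G\<^esub> (path_elem ` R :: (_ \<Rightarrow>\<^sub>0 'k) set)"
    by (auto simp: genideal_def)
qed

lemma path2_in_qpaths:
  assumes "fin_digraph Q" "composable Q \<alpha> \<beta>"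
  shows "path2 Q \<alpha> \<beta> \<in> qpaths Q"
proof -
  interpret fin_digraph Q by (rule assms)
  show ?thesis
    using assms(2) by (auto simp: qpaths_def path2_def composable_def awalk_def cas.simps)
qed


section \<open>The repetition and its relations within a layer\<close>

lemma tail_sink_arrow:
  assumes "t p \<in> new_sinks Q"
  obtains v where "v \<in> verts Q" "tail (blossom Q) (sink_arrow Q t p) = Old_vertex v"
proof -
  obtain v j where v: "v \<in> verts Q" "j < 2 - out_degree Q v" "t p = New_sink v j"
    using assms by (auto simp: new_sinks_def)
  then have "sink_arrow Q t p = New_out v j"
    unfolding sink_arrow_def by (intro the_equality) (auto simp: blossom_def)
  with v that show thesis by (simp add: blossom_def)
qed

lemma head_source_arrow:
  assumes "s p \<in> new_sources Q"
  obtains v where "v \<in> verts Q" "head (blossom Q) (source_arrow Q s p) = Old_vertex v"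
proof -
  obtain v j where v: "v \<in> verts Q" "j < 2 - in_degree Q v" "s p = New_source v j"
    using assms by (auto simp: new_sources_def)
  then have "source_arrow Q s p = New_in v j"
    unfolding source_arrow_def by (intro the_equality) (auto simp: blossom_def)
  with v that show thesis by (simp add: blossom_def)
qed

lemma repetition_simps:
  "verts (repetition Q s t k) = verts Q \<times> {1..k}"
  "Copy_arrow \<alpha> i \<in> arcs (repetition Q s t k) \<longleftrightarrow> \<alpha> \<in> arcs Q \<and> i \<in> {1..k}"
  "Connect p i \<in> arcs (repetition Q s t k) \<longleftrightarrow> p \<in> {1..defect Q} \<and> i \<in> {1..<k}"
  "tail (repetition Q s t k) (Copy_arrow \<alpha> i) = (tail Q \<alpha>, i)"
  "head (repetition Q s t k) (Copy_arrow \<alpha> i) = (head Q \<alpha>, i)"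
  "tail (repetition Q s t k) (Connect p i)
     = (old_vertex (tail (blossom Q) (sink_arrow Q t p)), i)"
  "head (repetition Q s t k) (Connect p i)
     = (old_vertex (head (blossom Q) (source_arrow Q s p)), Suc i)"
  by (auto simp: repetition_def)

context
  fixes Q :: "('v, 'e) pre_digraph"
    and I :: "(('v, 'e) qpath \<Rightarrow>\<^sub>0 'k::field) set"
    and Ibl :: "(('v bl_vertex, ('v, 'e) bl_arrow) qpath \<Rightarrow>\<^sub>0 'k) set"
    and s t :: "nat \<Rightarrow> 'v bl_vertex" and k :: nat
  assumes Q: "fin_digraph Q" and st: "blossom_labeling Q Ibl s t"
begin

lemma labels_new:
  assumes "p \<in> {1..defect Q}"
  shows "s p \<in> new_sources Q" "t p \<in> new_sinks Q"
  using st assms by (auto simp: blossom_labeling_def dest: bij_betwE)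

lemma fin_digraph_repetition: "fin_digraph (repetition Q s t k)"
proof -
  interpret Q: fin_digraph Q by (rule Q)
  let ?Qk = "repetition Q s t k"
  have "arcs ?Qk = case_prod Copy_arrow ` (arcs Q \<times> {1..k}) \<union>
      case_prod Connect ` ({1..defect Q} \<times> {1..<k})"
    by (auto simp: repetition_def)
  then have fin: "finite (arcs ?Qk)" by simp
  have "tail ?Qk a \<in> verts ?Qk \<and> head ?Qk a \<in> verts ?Qk" if "a \<in> arcs ?Qk" for a
  proof (cases a)
    case (Copy_arrow \<alpha> i)
    with that show ?thesis by (auto simp: repetition_simps)
  next
    case (Connect p i)
    with that have "p \<in> {1..defect Q}" by (simp add: repetition_simps)
    note new = labels_new[OF this]
    obtain u where "u \<in> verts Q" "tail (blossom Q) (sink_arrow Q t p) = Old_vertex u"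
      using new(2) by (rule tail_sink_arrow)
    moreover obtain v where "v \<in> verts Q" "head (blossom Q) (source_arrow Q s p) = Old_vertex v"
      using new(1) by (rule head_source_arrow)
    ultimately show ?thesis using Connect that by (simp add: repetition_simps)
  qed
  then show ?thesis
    using fin by unfold_locales (auto simp: repetition_simps)
qed

text \<open>
  A connecting arrow starts where the arrow into the corresponding new sink starts and ends where
  the arrow from the corresponding new source ends. A copied arrow and a connecting arrow are
  therefore composable as soon as the two arrows of the blossoming are.
\<close>

lemma composable_copy_connect:
  assumes "p \<in> {1..defect Q}" "i \<in> {1..<k}"
    and "relation (blossom Q) Ibl (Old_arrow \<alpha>) (sink_arrow Q t p)"
  shows "composable (repetition Q s t k) (Copy_arrow \<alpha> i) (Connect p i)"
proof -
  obtain u where "tail (blossom Q) (sink_arrow Q t p) = Old_vertex u"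
    using labels_new(2)[OF assms(1)] by (rule tail_sink_arrow)
  with assms show ?thesis
    by (auto simp: relation_def composable_def repetition_simps) (auto simp: blossom_def)
qed

lemma composable_connect_copy:
  assumes "p \<in> {1..defect Q}" "i \<in> {1..<k}"
    and "relation (blossom Q) Ibl (source_arrow Q s p) (Old_arrow \<beta>)"
  shows "composable (repetition Q s t k) (Connect p i) (Copy_arrow \<beta> (Suc i))"
proof -
  obtain v where "head (blossom Q) (source_arrow Q s p) = Old_vertex v"
    using labels_new(1)[OF assms(1)] by (rule head_source_arrow)
  with assms show ?thesis
    by (auto simp: relation_def composable_def repetition_simps) (auto simp: blossom_def)
qed

lemma repetition_relations_subset:
  "repetition_relations Q I Ibl s t k \<subseteq>
     {p \<in> qpaths (repetition Q s t k). length (snd p) = 2}"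
proof -
  have "\<exists>a b. r = path2 (repetition Q s t k) a b \<and> composable (repetition Q s t k) a b"
    if "r \<in> repetition_relations Q I Ibl s t k" for r
  proof -
    from that consider
      (1) \<alpha> \<beta> i where "r = path2 (repetition Q s t k) (Copy_arrow \<alpha> i) (Copy_arrow \<beta> i)"
        "i \<in> {1..k}" "relation Q I \<alpha> \<beta>"
    | (2) \<alpha> p i where "r = path2 (repetition Q s t k) (Copy_arrow \<alpha> i) (Connect p i)"
        "p \<in> {1..defect Q}" "i \<in> {1..<k}" "relation (blossom Q) Ibl (Old_arrow \<alpha>) (sink_arrow Q t p)"
    | (3) \<beta> p i where "r = path2 (repetition Q s t k) (Connect p i) (Copy_arrow \<beta> (Suc i))"
        "p \<in> {1..defect Q}" "i \<in> {1..<k}" "relation (blossom Q) Ibl (source_arrow Q s p) (Old_arrow \<beta>)"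
    | (4) p p' i where "r = path2 (repetition Q s t k) (Connect p i) (Connect p' (Suc i))"
        "p \<in> {1..defect Q}" "p' \<in> {1..defect Q}" "i \<in> {1..<k}" "Suc i \<in> {1..<k}"
        "relation (blossom Q) Ibl (source_arrow Q s p) (sink_arrow Q t p')"
      unfolding repetition_relations_def Let_def Suc_eq_plus1 by blast
    then show ?thesis
    proof cases
      case 1
      then have "composable (repetition Q s t k) (Copy_arrow \<alpha> i) (Copy_arrow \<beta> i)"
        by (auto simp: relation_def composable_def repetition_simps)
      with 1 show ?thesis by blast
    next
      case 2
      with composable_copy_connect show ?thesis by blast
    next
      case 3
      with composable_connect_copy show ?thesis by blast
    next
      case 4
      then have "composable (repetition Q s t k) (Connect p i) (Connect p' (Suc i))"
        by (auto simp: relation_def composable_def repetition_simps)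
      with 4 show ?thesis by blast
    qed
  qed
  then show ?thesis
    using path2_in_qpaths[OF fin_digraph_repetition] by (fastforce simp: path2_def)
qed

lemma composable_copies_iff:
  "composable (repetition Q s t k) (Copy_arrow \<alpha> i) (Copy_arrow \<beta> j)
     \<longleftrightarrow> composable Q \<alpha> \<beta> \<and> i = j \<and> i \<in> {1..k}"
  by (auto simp: composable_def repetition_simps)

lemma relation_copies_iff:
  "relation (repetition Q s t k) (repetition_ideal Q I Ibl s t k) (Copy_arrow \<alpha> i) (Copy_arrow \<beta> i)
     \<longleftrightarrow> relation Q I \<alpha> \<beta> \<and> i \<in> {1..k}"
  and nonrelation_copies_iff:
  "nonrelation (repetition Q s t k) (repetition_ideal Q I Ibl s t k) (Copy_arrow \<alpha> i) (Copy_arrow \<beta> i)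
     \<longleftrightarrow> nonrelation Q I \<alpha> \<beta> \<and> i \<in> {1..k}"
proof -
  have "path_elem (path2 (repetition Q s t k) (Copy_arrow \<alpha> i) (Copy_arrow \<beta> i))
       \<in> repetition_ideal Q I Ibl s t k
     \<longleftrightarrow> path2 (repetition Q s t k) (Copy_arrow \<alpha> i) (Copy_arrow \<beta> i)
       \<in> repetition_relations Q I Ibl s t k"
    unfolding repetition_ideal_def
    by (rule fin_digraph.path_elem_in_genideal_iff
        [OF fin_digraph_repetition repetition_relations_subset]) (simp add: path2_def)
  also have "\<dots> \<longleftrightarrow> relation Q I \<alpha> \<beta> \<and> i \<in> {1..k}"
    by (auto simp: repetition_relations_def Let_def path2_def repetition_simps)
  finally show "relation (repetition Q s t k) (repetition_ideal Q I Ibl s t k)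
        (Copy_arrow \<alpha> i) (Copy_arrow \<beta> i) \<longleftrightarrow> relation Q I \<alpha> \<beta> \<and> i \<in> {1..k}"
    "nonrelation (repetition Q s t k) (repetition_ideal Q I Ibl s t k)
        (Copy_arrow \<alpha> i) (Copy_arrow \<beta> i) \<longleftrightarrow> nonrelation Q I \<alpha> \<beta> \<and> i \<in> {1..k}"
    by (auto simp: relation_def nonrelation_def composable_copies_iff)
qed

end


section \<open>Cycles stay in a layer\<close>

text \<open>
  Oriented cycles and anticycles are both of this form. The step relation is a parameter so that
  the arguments about layers and rotation classes apply to both.
\<close>

definition cyclic_list :: "('e \<Rightarrow> 'e \<Rightarrow> bool) \<Rightarrow> 'e list \<Rightarrow> bool" where
  "cyclic_list N xs \<longleftrightarrow> xs \<noteq> [] \<and> distinct xs \<and>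
     (\<forall>i<length xs. N (xs ! i) (xs ! (Suc i mod length xs)))"

lemma oriented_cycle_iff: "oriented_cycle Q I = cyclic_list (nonrelation Q I)"
  and anticycle_iff: "anticycle Q I = cyclic_list (relation Q I)"
  by (auto simp: fun_eq_iff oriented_cycle_def anticycle_def cyclic_list_def)

lemma cyclic_list_mono:
  "cyclic_list M xs \<Longrightarrow> (\<And>a b. M a b \<Longrightarrow> N a b) \<Longrightarrow> cyclic_list N xs"
  by (auto simp: cyclic_list_def)

text \<open>
  Read periodically, the values form a nondecreasing sequence that returns to its starting value.
\<close>

lemma cyclic_nondecreasing_imp_constant:
  fixes f :: "'e \<Rightarrow> 'a::order"
  assumes cyc: "cyclic_list (\<lambda>a b. f a \<le> f b) xs" and ij: "i < length xs" "j < length xs"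
  shows "f (xs ! i) = f (xs ! j)"
proof -
  let ?n = "length xs"
  let ?g = "\<lambda>i. f (xs ! (i mod ?n))"
  have n: "?n > 0" using ij by linarith
  have step: "?g i \<le> ?g (Suc i)" for i
    using cyc n by (auto simp: cyclic_list_def mod_Suc_eq dest!: spec[of _ "i mod ?n"])
  have mono: "?g i \<le> ?g j" if "i \<le> j" for i j
    using lift_Suc_mono_le[of ?g, OF step that] .
  have "f (xs ! i) \<le> f (xs ! j)" if "i < ?n" "j < ?n" for i j
    using mono[of i "j + ?n"] that by simp
  with ij show ?thesis by (simp add: order_antisym)
qed

text \<open>
  The layer of the tail does not decrease from one arrow to the next, so it is constant along a
  closed walk; a connecting arrow would make it grow.
\<close>

lemma repetition_cyclic_list_in_layer:
  assumes cyc: "cyclic_list (composable (repetition Q s t k)) xs"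
  obtains i \<rho> where "i \<in> {1..k}" "xs = map (\<lambda>\<alpha>. Copy_arrow \<alpha> i) \<rho>"
proof -
  let ?Qk = "repetition Q s t k" and ?n = "length xs"
  define layer where "layer a = snd (tail ?Qk a)" for a
  have layer_head: "layer a \<le> snd (head ?Qk a)" for a
    by (cases a) (auto simp: layer_def repetition_simps)
  have comp: "composable ?Qk (xs ! j) (xs ! (Suc j mod ?n))" if "j < ?n" for j
    using cyc that by (simp add: cyclic_list_def)
  have ne: "?n > 0" using cyc by (simp add: cyclic_list_def)
  have "cyclic_list (\<lambda>a b. layer a \<le> layer b) xs"
  proof (rule cyclic_list_mono[OF cyc])
    fix a b assume "composable ?Qk a b"
    then show "layer a \<le> layer b" using layer_head[of a] by (simp add: composable_def layer_def)
  qed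
  note const = cyclic_nondecreasing_imp_constant[OF this]
  define i where "i = layer (xs ! 0)"
  have copy: "\<exists>\<alpha>. xs ! j = Copy_arrow \<alpha> i" if j: "j < ?n" for j
  proof (cases "xs ! j")
    case (Copy_arrow \<alpha> i')
    with const[OF j ne] show ?thesis by (simp add: i_def layer_def repetition_simps)
  next
    case (Connect p i')
    have "Suc j mod ?n < ?n" using ne by simp
    with const[OF this j] have "layer (xs ! j) = snd (head ?Qk (xs ! j))"
      using comp[OF j] by (simp add: composable_def layer_def)
    with Connect show ?thesis by (simp add: layer_def repetition_simps)
  qed
  show thesis
  proof (rule that)
    show "i \<in> {1..k}"
      using copy[OF ne] comp[OF ne] by (auto simp: composable_def repetition_simps)
    show "xs = map (\<lambda>\<alpha>. Copy_arrow \<alpha> i) (map (\<lambda>a. case a of Copy_arrow \<alpha> _ \<Rightarrow> \<alpha>) xs)"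
      using copy by (intro nth_equalityI) (auto, metis rep_arrow.case(1))
  qed
qed

lemma repetition_cyclic_list_iff:
  assumes comp: "\<And>a b. N' a b \<Longrightarrow> composable (repetition Q s t k) a b"
    and copies: "\<And>\<alpha> \<beta> i. N' (Copy_arrow \<alpha> i) (Copy_arrow \<beta> i) \<longleftrightarrow> N \<alpha> \<beta> \<and> i \<in> {1..k}"
  shows "cyclic_list N' xs \<longleftrightarrow>
    (\<exists>i\<in>{1..k}. \<exists>\<rho>. cyclic_list N \<rho> \<and> xs = map (\<lambda>\<alpha>. Copy_arrow \<alpha> i) \<rho>)"
proof -
  have layer: "cyclic_list N' (map (\<lambda>\<alpha>. Copy_arrow \<alpha> i) \<rho>) \<longleftrightarrow> cyclic_list N \<rho>"
    if i: "i \<in> {1..k}" for i \<rho>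
  proof -
    have "map (\<lambda>\<alpha>. Copy_arrow \<alpha> i) \<rho> ! (Suc j mod length \<rho>)
        = Copy_arrow (\<rho> ! (Suc j mod length \<rho>)) i" if "j < length \<rho>" for j
      using that by (intro nth_map) (auto intro: mod_less_divisor)
    then show ?thesis
      using i by (auto simp: cyclic_list_def distinct_map inj_on_def copies)
  qed
  show ?thesis
  proof
    assume cyc: "cyclic_list N' xs"
    obtain i \<rho> where "i \<in> {1..k}" "xs = map (\<lambda>\<alpha>. Copy_arrow \<alpha> i) \<rho>"
      using repetition_cyclic_list_in_layer[OF cyclic_list_mono[OF cyc comp]] by blast
    with cyc layer show "\<exists>i\<in>{1..k}. \<exists>\<rho>. cyclic_list N \<rho> \<and> xs = map (\<lambda>\<alpha>. Copy_arrow \<alpha> i) \<rho>"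
      by blast
  qed (use layer in blast)
qed


section \<open>Counting rotation classes\<close>

lemma rotation_class_map: "rotation_class (map f xs) = map f ` rotation_class xs"
  by (auto simp: rotation_class_def rotate_map)

lemma rotation_class_self: "xs \<in> rotation_class xs"
  unfolding rotation_class_def by (auto intro!: exI[of _ 0])

text \<open>
  Rotating commutes with copying, so the classes of the copies are the copies of the classes. The
  index of a copy can be read off from any of its entries, and this is where nonempty lists matter:
  all copies of the empty list coincide.
\<close>

lemma card_rotation_classes_of_copies:
  fixes c :: "'i \<Rightarrow> 'e \<Rightarrow> 'f"
  assumes inj: "\<And>i \<alpha> j \<beta>. c i \<alpha> = c j \<beta> \<longleftrightarrow> i = j \<and> \<alpha> = \<beta>"
    and ne: "[] \<notin> S"
    and S': "S' = (\<Union>i\<in>J. map (c i) ` S)"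
  shows "card (rotation_class ` S') = card J * card (rotation_class ` S)"
proof -
  let ?h = "\<lambda>(i, C). map (c i) ` C"
  have inj_c: "inj (map (c i))" for i
    using inj by (simp add: inj_def)
  have "inj_on ?h (J \<times> rotation_class ` S)"
  proof (rule inj_onI, clarsimp)
    fix i j xs ys
    assume xs: "xs \<in> S" and eq: "map (c i) ` rotation_class xs = map (c j) ` rotation_class ys"
    obtain a as where a: "xs = a # as" using xs ne by (cases xs) auto
    obtain zs where "map (c i) xs = map (c j) zs"
      using eq rotation_class_self[of xs] by blast
    then have ij: "i = j" using a by (cases zs) (auto simp: inj)
    with eq show "i = j \<and> rotation_class xs = rotation_class ys"
      by (simp add: inj_image_eq_iff[OF inj_c])
  qed
  moreover have "?h ` (J \<times> rotation_class ` S) = (\<Union>i\<in>J. (`) (map (c i)) ` rotation_class ` S)"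
    by auto
  then have "?h ` (J \<times> rotation_class ` S) = rotation_class ` S'"
    unfolding S' by (simp add: image_UN image_image rotation_class_map)
  ultimately have "card (rotation_class ` S') = card (J \<times> rotation_class ` S)"
    by (metis card_image)
  then show ?thesis by (simp add: card_cartesian_product)
qed

lemma card_rotation_classes_repetition:
  assumes cyc: "\<And>xs. cyclic_list N' xs \<longleftrightarrow>
      (\<exists>i\<in>{1..k}. \<exists>\<rho>. cyclic_list N \<rho> \<and> xs = map (\<lambda>\<alpha>. Copy_arrow \<alpha> i) \<rho>)"
    and deg: "\<And>i \<rho>. d' (map (\<lambda>\<alpha>. Copy_arrow \<alpha> i) \<rho>) = d \<rho>"
  shows "card (rotation_class ` {xs. cyclic_list N' xs \<and> d' xs = l})
       = k * card (rotation_class ` {\<rho>. cyclic_list N \<rho> \<and> d \<rho> = l})"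
proof -
  have "{xs. cyclic_list N' xs \<and> d' xs = l} =
      (\<Union>i\<in>{1..k}. map (\<lambda>\<alpha>. Copy_arrow \<alpha> i) ` {\<rho>. cyclic_list N \<rho> \<and> d \<rho> = l})"
    by (auto simp: cyc deg)
  from card_rotation_classes_of_copies[OF _ _ this] show ?thesis
    by (auto simp: cyclic_list_def)
qed

theorem proposition6p9:
  fixes Q :: "('v, 'e) pre_digraph"
    and I :: "(('v, 'e) qpath \<Rightarrow>\<^sub>0 'k::alg_closed_field) set"
    and Ibl :: "(('v bl_vertex, ('v, 'e) bl_arrow) qpath \<Rightarrow>\<^sub>0 'k) set"
    and s t :: "nat \<Rightarrow> 'v bl_vertex"
    and deg :: "'e \<Rightarrow> int" and w :: "nat \<Rightarrow> int" and k l :: nat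
  assumes "locally_gentle Q I"
    and "Digraph_Component.connected Q"
    and "arcs Q \<noteq> {}"
    and "maximal_paths Q I <+> trivial_maximal_vertices Q I \<noteq> {}"
    and "blossom_ideal Q I Ibl"
    and "blossom_labeling Q Ibl s t"
    and "k > 0"
  shows "phi0 (repetition Q s t k) (repetition_ideal Q I Ibl s t k) (repetition_degree deg w) l
       = k * phi0 Q I deg l"
proof -
  let ?Qk = "repetition Q s t k" and ?Ik = "repetition_ideal Q I Ibl s t k"
  have Q: "fin_digraph Q" using assms(1) by (simp add: locally_gentle_def)
  note copies = nonrelation_copies_iff[OF Q assms(6)] relation_copies_iff[OF Q assms(6)]
  have "cyclic_list (nonrelation ?Qk ?Ik) xs \<longleftrightarrow>
      (\<exists>i\<in>{1..k}. \<exists>\<rho>. cyclic_list (nonrelation Q I) \<rho> \<and> xs = map (\<lambda>\<alpha>. Copy_arrow \<alpha> i) \<rho>)" for xs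
    by (rule repetition_cyclic_list_iff) (auto simp: copies nonrelation_def[of ?Qk])
  note cycles = card_rotation_classes_repetition[OF this]
  have "cyclic_list (relation ?Qk ?Ik) xs \<longleftrightarrow>
      (\<exists>i\<in>{1..k}. \<exists>\<rho>. cyclic_list (relation Q I) \<rho> \<and> xs = map (\<lambda>\<alpha>. Copy_arrow \<alpha> i) \<rho>)" for xs
    by (rule repetition_cyclic_list_iff) (auto simp: copies relation_def[of ?Qk])
  note anticycles = card_rotation_classes_repetition[OF this]
  have degrees:
    "cycle_degree (repetition_degree deg w) (map (\<lambda>\<alpha>. Copy_arrow \<alpha> i) \<rho>) = cycle_degree deg \<rho>"
    "anticycle_degree (repetition_degree deg w) (map (\<lambda>\<alpha>. Copy_arrow \<alpha> i) \<rho>) = anticycle_degree deg \<rho>"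
    for i \<rho>
    by (simp_all add: cycle_degree_def anticycle_degree_def o_def)
  show ?thesis
    unfolding phi0_def oriented_cycle_iff anticycle_iff
    by (simp only: distrib_left
        cycles[where d = "cycle_degree deg" and d' = "cycle_degree (repetition_degree deg w)",
          OF degrees(1)]
        anticycles[where d = "anticycle_degree deg" and d' = "anticycle_degree (repetition_degree deg w)",
          OF degrees(2)])
qed

end
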